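(* In the setting described in the context (a process $(S_n)_{n\ge1}$ built from i.i.d. random variables $(X_n)_{n\ge1}$ whose common distribution has tail $\overline F$ regularly varying of index $-\alpha$, $\alpha>0$), assume that conditions (S1)–(S7) stated there hold. Then $$P\{M>t\}\sim r(t)\quad\text{as }t\to\infty,\qquad\text{where } r(t)=U(t)\,\overline F(\chi(t))\int_0^\infty\rho(v)^{-\alpha}\,dv .$$
   Context: Setting. $(X_n)_{n\ge1}$ are i.i.d. real random variables with distribution function $F$ whose tail $\overline F=1-F$ is regularly varying with index $-\alpha$. Each $S_n$, $n\ge1$, is a real-valued measurable function of the sequence $(X_n)_{n\ge1}$, and $M=\max_{n\ge1}S_n$. Set $\psi_{i,n}(x)=E(S_i\mid X_n=x)$ for $i,n\ge1$, and $\psi_n(x)=\max_{i\ge1}\psi_{i,n}(x)$. It is assumed that there is $t_0$ such that each $\psi_n$ is increasing and invertible from the preimage of $(t_0,\infty)$ onto $(t_0,\infty)$; $\psi_n^{-1}$ is the corresponding inverse. (S1) There are regularly varying functions $U$ and $\chi$ with limit $+\infty$ at infinity, and a function $\rho$ continuous on $(0,\infty)$, bounded away from $0$ on any compact subset of $(0,\infty)$, with $\rho^{-\alpha}$ Lebesgue integrable on $[0,\infty)$, such that $\psi^{-1}_{\lfloor xU(t)\rfloor}(t)\sim\chi(t)\rho(x)$ as $t\to\infty$, uniformly in $x$ in any compact subset of $(0,\infty)$. Define $r(t)=U(t)\overline F(\chi(t))\int_0^\infty\rho(v)^{-\alpha}dv$. For $\epsilon\in(0,1)$ let $I_{\epsilon,t}=\{n\in\mathbb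 N:\epsilon U(t)\le n\le U(t)/\epsilon\}$ and $N_{\epsilon,t}=\lfloor U(t)/\epsilon\rfloor$. (S2) $r(t)\to0$ and $r(t)\sim\sum_{n\ge1}\overline F(\psi_n^{-1}(t))$ as $t\to\infty$, and $$\lim_{\epsilon\to0}\liminf_{t\to\infty}\frac1{r(t)}\sum_{n\in I_{\epsilon,t}}\overline F(\psi_n^{-1}(t))=\lim_{\epsilon\to0}\limsup_{t\to\infty}\frac1{r(t)}\sum_{n\in I_{\epsilon,t}}\overline F(\psi_n^{-1}(t))=1.$$ (S3) $\lim_{\epsilon\to0}\limsup_{t\to\infty}r(t)^{-1}P\{\exists n\le\epsilon U(t):S_n>t\}=0$. (S4) $\lim_{\epsilon\to0}\limsup_{t\to\infty}r(t)^{-1}P\{\exists n\ge U(t)/\epsilon:S_n>t\}=0$. For $\theta>0$ let $B_i=\{X_i\le\theta\chi(t)\}$, with complement $B_i^{c}$. (S5) For every $\epsilon\in(0,1)$ there is $\theta>0$ such that $P\bigl(\bigcup_{i\in I_{\epsilon,t}}(\{S_i>t\}\cap\bigcap_{1\le n\le i}B_n)\bigr)=o(r(t))$ as $t\to\infty$. For $\epsilon\in(0,1)$, $\theta,\delta>0$ and $N=N_{\epsilon,t}$ let $C_n=\bigcap_{1\le i\le N,\,i\ne n}B_i$ and $D_n=\bigcap_{1\le i\le N}\{|S_i-\psi_{i,n}(X_n)|\le\delta t\}$. (S6) For every $\epsilon\in(0,1)$ and every $\delta>0$, for all sufficiently small $\theta>0$, $P\bigl(\bigcup_{n\in I_{\epsilon,t}}B_n^{c}\cap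 C_n\cap D_n^{c}\bigr)=o(r(t))$ as $t\to\infty$. (S7) Let $i(n,x)$ be an integer $i$ maximizing $\psi_{i,n}(x)$. For all positive $\delta$ and $\theta$ less than $1$ there is $\eta>0$ such that for all $t$ large enough, $\{i(n,x):\theta\chi(t)\le x\le\chi(t)/\theta,\ n\in I_{\delta,t}\}\subset I_{\eta,t}$. *)

theory Defs
  imports "HOL-Probability.Probability" "HOL-Library.Landau_Symbols"
begin

definition regularly_varying :: "(real \<Rightarrow> real) \<Rightarrow> real \<Rightarrow> bool" where
  "regularly_varying f \<kappa> \<longleftrightarrow>
     (\<exists>a. f \<in> borel_measurable (restrict_space borel {a..}) \<and> (\<forall>t\<ge>a. 0 < f t)) \<and>
     (\<forall>c>0. ((\<lambda>t. f (c * t) / f t) \<longlongrightarrow> c powr \<kappa>) at_top)"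

definition tail :: "(real \<Rightarrow> real) \<Rightarrow> real \<Rightarrow> real" where
  "tail F x = 1 - F x"

text \<open>
  The function \<open>g\<close> is a version of \<open>x \<mapsto> E(Y | X = x)\<close>. The finiteness of \<open>E(|Y| | X)\<close>
  is the requirement that the conditional expectation exists; it holds whenever \<open>Y\<close> is
  integrable, and without it \<^const>\<open>real_cond_exp\<close> carries no information.
\<close>
definition cond_exp_version ::
    "'a measure \<Rightarrow> ('a \<Rightarrow> real) \<Rightarrow> ('a \<Rightarrow> real) \<Rightarrow> (real \<Rightarrow> real) \<Rightarrow> bool" where
  "cond_exp_version P Y X g \<longleftrightarrow>
     g \<in> borel_measurable borel \<and>
     (AE \<omega> in P. nn_cond_exp P (vimage_algebra (space P) X borel) (\<lambda>\<omega>. ennreal \<bar>Y \<omega>\<bar>) \<omega> < \<infinity>) \<and>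
     (AE \<omega> in P. real_cond_exp P (vimage_algebra (space P) X borel) Y \<omega> = g (X \<omega>))"

text \<open>
  The argument \<open>\<psi> i n x\<close> stands for \<open>E(S\<^sub>i | X\<^sub>n = x)\<close>; all indices start at 1. The supremum
  in \<open>psi_max\<close> is meaningful as a maximum only under an attainment hypothesis such as \<open>is_argmax\<close>.
\<close>
definition is_argmax :: "(nat \<Rightarrow> nat \<Rightarrow> real \<Rightarrow> real) \<Rightarrow> nat \<Rightarrow> real \<Rightarrow> nat \<Rightarrow> bool" where
  "is_argmax \<psi> n x i \<longleftrightarrow> 1 \<le> i \<and> (\<forall>j\<ge>1. \<psi> j n x \<le> \<psi> i n x)"

definition psi_max :: "(nat \<Rightarrow> nat \<Rightarrow> real \<Rightarrow> real) \<Rightarrow> nat \<Rightarrow> real \<Rightarrow> real" where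
  "psi_max \<psi> n x = (SUP i\<in>{1..}. \<psi> i n x)"

text \<open>
  ``\<open>f\<close> is increasing, and invertible from the preimage of \<open>(t\<^sub>0, \<infinity>)\<close> onto \<open>(t\<^sub>0, \<infinity>)\<close>''.
  Points outside the preimage are unconstrained except that they lie below it, so this is implied
  by global monotonicity of \<open>f\<close> together with the bijection. Strict monotonicity on the preimage
  alone would allow the preimage to have gaps.
\<close>
definition increasing_invertible_above :: "real \<Rightarrow> (real \<Rightarrow> real) \<Rightarrow> bool" where
  "increasing_invertible_above t0 f \<longleftrightarrow>
     (\<forall>x y. t0 < f x \<and> x < y \<longrightarrow> f x < f y) \<and>
     bij_betw f {x. t0 < f x} {t0<..}"

definition psi_inv :: "(nat \<Rightarrow> nat \<Rightarrow> real \<Rightarrow> real) \<Rightarrow> real \<Rightarrow> nat \<Rightarrow> real \<Rightarrow> real" where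
  "psi_inv \<psi> t0 n = the_inv_into {x. t0 < psi_max \<psi> n x} (psi_max \<psi> n)"

definition rate ::
    "real \<Rightarrow> (real \<Rightarrow> real) \<Rightarrow> (real \<Rightarrow> real) \<Rightarrow> (real \<Rightarrow> real) \<Rightarrow> (real \<Rightarrow> real) \<Rightarrow> real \<Rightarrow> real" where
  "rate \<alpha> F U chi \<rho> t = U t * tail F (chi t) * (LINT v:{0..}|lborel. \<rho> v powr (- \<alpha>))"

definition I_window :: "(real \<Rightarrow> real) \<Rightarrow> real \<Rightarrow> real \<Rightarrow> nat set" where
  "I_window U \<epsilon> t = {n. 1 \<le> n \<and> \<epsilon> * U t \<le> real n \<and> real n \<le> U t / \<epsilon>}"

definition N_bound :: "(real \<Rightarrow> real) \<Rightarrow> real \<Rightarrow> real \<Rightarrow> nat" where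
  "N_bound U \<epsilon> t = nat \<lfloor>U t / \<epsilon>\<rfloor>"

definition B_event ::
    "'a measure \<Rightarrow> (nat \<Rightarrow> 'a \<Rightarrow> real) \<Rightarrow> (real \<Rightarrow> real) \<Rightarrow> real \<Rightarrow> real \<Rightarrow> nat \<Rightarrow> 'a set" where
  "B_event P X chi \<theta> t i = {\<omega> \<in> space P. X i \<omega> \<le> \<theta> * chi t}"

definition C_event ::
    "'a measure \<Rightarrow> (nat \<Rightarrow> 'a \<Rightarrow> real) \<Rightarrow> (real \<Rightarrow> real) \<Rightarrow> (real \<Rightarrow> real) \<Rightarrow>
     real \<Rightarrow> real \<Rightarrow> real \<Rightarrow> nat \<Rightarrow> 'a set" where
  "C_event P X U chi \<epsilon> \<theta> t n =
     {\<omega> \<in> space P. \<forall>i\<in>{1..N_bound U \<epsilon> t} - {n}. \<omega> \<in> B_event P X chi \<theta> t i}"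

definition D_event ::
    "'a measure \<Rightarrow> (nat \<Rightarrow> 'a \<Rightarrow> real) \<Rightarrow> (nat \<Rightarrow> 'a \<Rightarrow> real) \<Rightarrow> (nat \<Rightarrow> nat \<Rightarrow> real \<Rightarrow> real) \<Rightarrow>
     (real \<Rightarrow> real) \<Rightarrow> real \<Rightarrow> real \<Rightarrow> real \<Rightarrow> nat \<Rightarrow> 'a set" where
  "D_event P X S \<psi> U \<epsilon> \<delta> t n =
     {\<omega> \<in> space P. \<forall>i\<in>{1..N_bound U \<epsilon> t}. \<bar>S i \<omega> - \<psi> i n (X n \<omega>)\<bar> \<le> \<delta> * t}"

end

theory Submission imports Defs begin

text \<open>
  A single large \<open>X n\<close> accounts for the event \<open>M > t\<close>. By (S3)--(S5), up to an error that is
  small relative to \<open>r\<close>, some \<open>X n\<close> with \<open>n \<le> U t / \<epsilon>\<close> exceeds \<open>\<theta> * chi t\<close>; two such indices have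
  probability \<open>O(r\<^sup>2)\<close>, and by (S6) all \<open>S i\<close> are then within \<open>\<delta> * t\<close> of \<open>\<psi> i n (X n)\<close>. So \<open>M > t\<close>
  forces \<open>X n\<close> above \<open>psi_inv \<psi> t0 n ((1 - \<delta>) * t)\<close>, and conversely the disjoint events that
  \<open>X n\<close> exceeds \<open>psi_inv \<psi> t0 n ((1 + \<delta>) * t)\<close> while all other \<open>X m\<close> are small essentially imply
  \<open>M > t\<close>. Both sums of tails are governed by (S2) at \<open>(1 \<plusminus> \<delta>) * t\<close>, and \<open>r\<close> is regularly
  varying, so \<open>\<delta> \<rightarrow> 0\<close> gives the claim.

  The order in which the parameters are chosen matters. Upper bound: \<open>\<epsilon>\<close>, then \<open>\<theta>\<close> from (S5), then
  a smaller \<open>\<epsilon>'\<close> making a jump above \<open>\<theta> * chi t\<close> before \<open>\<epsilon>' * U t\<close> unlikely, and only then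
  \<open>\<theta>' < \<theta>\<close> from (S6) for \<open>\<epsilon>'\<close>. Lower bound: \<open>\<epsilon>\<close>, then \<open>\<theta>\<close>, \<open>\<eta>\<close> from (S7), and \<open>\<theta>' < \<theta>\<close> last.
\<close>

section \<open>Ratios of a monotone regularly varying tail\<close>

text \<open>Monotonicity replaces uniform convergence in the ratio. For \<open>u\<close> on either
  side of \<open>c\<close>, \<open>g t\<close> is eventually on the corresponding side of
  \<open>u * f t\<close>, so \<open>T (g t)\<close> is compared with \<open>T (u * f t)\<close>,
  whose ratio to \<open>T (f t)\<close> tends to \<open>u powr \<kappa>\<close>. Continuity of the
  power lets \<open>u\<close> be taken close enough to \<open>c\<close>.\<close>

lemma tail_ratio_tendsto:
  assumes "antimono T" "regularly_varying T \<kappa>" "0 < c"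
    and f: "filterlim f at_top at_top"
    and gf: "((\<lambda>t. g t / f t) \<longlongrightarrow> c) at_top"
  shows "((\<lambda>t. T (g t) / T (f t)) \<longlongrightarrow> c powr \<kappa>) at_top"
proof -
  have lim: "((\<lambda>t. T (u * f t) / T (f t)) \<longlongrightarrow> u powr \<kappa>) at_top" if "0 < u" for u
    using filterlim_compose[OF _ f, of "\<lambda>t. T (u * t) / T t"] that assms(2)
    by (auto simp: regularly_varying_def)
  obtain a where a: "\<And>t. a \<le> t \<Longrightarrow> 0 < T t"
    using assms(2) unfolding regularly_varying_def by blast
  have pos: "\<forall>\<^sub>F t in at_top. 0 < f t \<and> 0 < T (f t)"
    using filterlim_at_top_dense[THEN iffD1, OF f, rule_format, of "max 0 a"]
    by eventually_elim (auto intro!: a)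
  have cont: "((\<lambda>u. u powr \<kappa>) \<longlongrightarrow> c powr \<kappa>) (at c within S)" for S
    using \<open>0 < c\<close> by (intro tendsto_intros) auto
  show ?thesis
  proof (rule order_tendstoI)
    fix b assume "b < c powr \<kappa>"
    then have "\<forall>\<^sub>F u in at_right c. b < u powr \<kappa>"
      by (rule order_tendstoD(1)[OF cont])
    then obtain u where u: "c < u" "b < u powr \<kappa>"
      using eventually_happens[OF eventually_conj[OF _ eventually_at_right_less[of c]]] by auto
    have "\<forall>\<^sub>F t in at_top. g t / f t < u" "\<forall>\<^sub>F t in at_top. b < T (u * f t) / T (f t)"
      using order_tendstoD(2)[OF gf \<open>c < u\<close>] order_tendstoD(1)[OF lim u(2)] u \<open>0 < c\<close> by auto
    then show "\<forall>\<^sub>F t in at_top. b < T (g t) / T (f t)"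
      using pos
    proof eventually_elim
      case (elim t)
      then have "T (u * f t) \<le> T (g t)"
        by (intro antimonoD[OF assms(1)]) (simp add: divide_simps)
      then show ?case
        using elim by (meson divide_right_mono less_eq_real_def less_le_trans)
    qed
  next
    fix b assume "b > c powr \<kappa>"
    then have "\<forall>\<^sub>F u in at_left c. b > u powr \<kappa>"
      by (rule order_tendstoD(2)[OF cont])
    moreover have "\<forall>\<^sub>F u in at_left c. u \<in> {0<..<c}"
      using \<open>0 < c\<close> by (rule eventually_at_left_real)
    ultimately obtain u where u: "0 < u" "u < c" "b > u powr \<kappa>"
      using eventually_happens[OF eventually_conj] by (metis (no_types, lifting) greaterThanLessThan_iff trivial_limit_at_left_real)
    have "\<forall>\<^sub>F t in at_top. g t / f t > u" "\<forall>\<^sub>F t in at_top. b > T (u * f t) / T (f t)"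
      using order_tendstoD(1)[OF gf \<open>u < c\<close>] order_tendstoD(2)[OF lim u(3)] u by auto
    then show "\<forall>\<^sub>F t in at_top. b > T (g t) / T (f t)"
      using pos
    proof eventually_elim
      case (elim t)
      then have "T (u * f t) \<ge> T (g t)"
        by (intro antimonoD[OF assms(1)]) (simp add: divide_simps)
      then show ?case
        using elim by (meson divide_right_mono less_eq_real_def le_less_trans)
    qed
  qed
qed

section \<open>Inversion of the maximal conditional mean, and index windows\<close>

text \<open>Strict increase is available only from points where \<open>f\<close> exceeds
  \<open>t0\<close>. If \<open>t < f x\<close> with \<open>x\<close> left of the preimage
  \<open>?y\<close> of \<open>t\<close>, then \<open>x\<close> is such a point, and
  \<open>f x < f ?y = t\<close> is a contradiction.\<close>

lemma increasing_invertible_above_less_iff: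
  assumes "increasing_invertible_above t0 f" "t0 < t"
  shows "t < f x \<longleftrightarrow> the_inv_into {x. t0 < f x} f t < x"
proof -
  let ?y = "the_inv_into {x. t0 < f x} f t"
  have mono: "\<And>x y. t0 < f x \<Longrightarrow> x < y \<Longrightarrow> f x < f y" and bij: "bij_betw f {x. t0 < f x} {t0<..}"
    using assms(1) by (auto simp: increasing_invertible_above_def)
  have "f ?y = t"
    using f_the_inv_into_f_bij_betw[OF bij] assms(2) by auto
  then show ?thesis
    using mono[of ?y x] mono[of x ?y] assms(2) by (metis less_trans not_less_iff_gr_or_eq)
qed

text \<open>An argmax bounds the family from above, so the real-valued \<open>SUP\<close> is a
  genuine maximum.\<close>

lemma psi_max_eq: "is_argmax \<psi> n x i \<Longrightarrow> psi_max \<psi> n x = \<psi> i n x"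
  unfolding psi_max_def is_argmax_def by (intro cSup_eq_maximum) auto

lemma psi_le_psi_max: "is_argmax \<psi> n x j \<Longrightarrow> 1 \<le> i \<Longrightarrow> \<psi> i n x \<le> psi_max \<psi> n x"
  using psi_max_eq[of \<psi> n x j] by (auto simp: is_argmax_def)

lemma I_window_subset: "I_window U \<epsilon> t \<subseteq> {1..N_bound U \<epsilon> t}"
  by (auto simp: I_window_def N_bound_def intro!: le_nat_floor)

lemma finite_I_window [simp]: "finite (I_window U \<epsilon> t)"
  using finite_subset[OF I_window_subset] by simp

lemma N_bound_le: "0 < \<epsilon> \<Longrightarrow> 0 \<le> U t \<Longrightarrow> real (N_bound U \<epsilon> t) \<le> U t / \<epsilon>"
  by (simp add: N_bound_def)

lemma I_window_antimono:
  assumes "0 < \<epsilon>'" "\<epsilon>' \<le> \<epsilon>" "0 \<le> U t"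
  shows "I_window U \<epsilon> t \<subseteq> I_window U \<epsilon>' t"
proof -
  have "\<epsilon>' * U t \<le> \<epsilon> * U t" "U t / \<epsilon> \<le> U t / \<epsilon>'"
    using assms by (auto intro: mult_right_mono divide_left_mono)
  then show ?thesis
    by (auto simp: I_window_def)
qed

section \<open>Exceedance probabilities for i.i.d. variables\<close>

locale iid_tail = prob_space M for M :: "'a measure" +
  fixes X :: "nat \<Rightarrow> 'a \<Rightarrow> real" and F :: "real \<Rightarrow> real"
  assumes indep: "indep_vars (\<lambda>_. borel) X {1..}"
    and ident: "\<And>n. 1 \<le> n \<Longrightarrow> cdf (distr M borel (X n)) = F"
begin

lemma X_meas [measurable]: "1 \<le> n \<Longrightarrow> X n \<in> borel_measurable M"
  using indep by (auto simp: indep_vars_def)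

lemma prob_gt:
  assumes "1 \<le> n"
  shows "prob {\<omega> \<in> space M. x < X n \<omega>} = tail F x"
proof -
  have [measurable]: "X n \<in> borel_measurable M" using assms by simp
  have "F x = prob (X n -` {..x} \<inter> space M)"
    using assms by (simp flip: ident[OF assms] add: cdf_def measure_distr)
  then have "1 - F x = prob (space M - (X n -` {..x} \<inter> space M))"
    by (subst prob_compl) auto
  also have "space M - (X n -` {..x} \<inter> space M) = {\<omega> \<in> space M. x < X n \<omega>}"
    by auto
  finally show ?thesis
    by (simp add: tail_def)
qed

lemma tail_nonneg: "0 \<le> tail F x"
  using prob_gt[of 1 x] by (metis measure_nonneg order_refl)

lemma antimono_tail: "antimono (tail F)"
proof (rule antimonoI)
  fix x y :: real assume "x \<le> y"
  then have "prob {\<omega> \<in> space M. y < X 1 \<omega>} \<le> prob {\<omega> \<in> space M. x < X 1 \<omega>}"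
    by (intro finite_measure_mono) auto
  then show "tail F y \<le> tail F x"
    by (simp add: prob_gt)
qed

lemma prob_ex_gt_le:
  assumes "finite J" "J \<subseteq> {1..}"
  shows "prob {\<omega> \<in> space M. \<exists>n\<in>J. x < X n \<omega>} \<le> real (card J) * tail F x"
proof -
  have "prob (\<Union>n\<in>J. {\<omega> \<in> space M. x < X n \<omega>}) \<le> (\<Sum>n\<in>J. prob {\<omega> \<in> space M. x < X n \<omega>})"
    using assms by (intro finite_measure_subadditive_finite) (auto simp: subset_eq)
  also have "\<dots> = (\<Sum>n\<in>J. tail F x)"
    using assms by (intro sum.cong prob_gt) auto
  also have "(\<Union>n\<in>J. {\<omega> \<in> space M. x < X n \<omega>}) = {\<omega> \<in> space M. \<exists>n\<in>J. x < X n \<omega>}"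
    by auto
  finally show ?thesis by simp
qed

lemma prob_two_gt:
  assumes "1 \<le> n" "1 \<le> m" "n \<noteq> m"
  shows "prob {\<omega> \<in> space M. a < X n \<omega> \<and> b < X m \<omega>} = tail F a * tail F b"
proof -
  let ?A = "\<lambda>i. if i = n then {a<..} else {b<..}"
  have "prob (\<Inter>i\<in>{n,m}. X i -` ?A i \<inter> space M) = (\<Prod>i\<in>{n,m}. prob (X i -` ?A i \<inter> space M))"
    using assms by (intro indep_varsD[OF indep]) auto
  also have "\<dots> = prob {\<omega> \<in> space M. a < X n \<omega>} * prob {\<omega> \<in> space M. b < X m \<omega>}"
    using assms by (auto intro!: arg_cong2[where f="(*)"] arg_cong[where f=prob])
  also have "(\<Inter>i\<in>{n,m}. X i -` ?A i \<inter> space M) = {\<omega> \<in> space M. a < X n \<omega> \<and> b < X m \<omega>}"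
    using assms by auto
  finally show ?thesis
    using assms by (simp add: prob_gt)
qed

lemma prob_gt_ex_other_le:
  assumes "finite J" "J \<subseteq> {1..}" "1 \<le> n"
  shows "prob {\<omega> \<in> space M. a < X n \<omega> \<and> (\<exists>m\<in>J - {n}. b < X m \<omega>)} \<le> tail F a * (real (card J) * tail F b)"
proof -
  have [measurable]: "X n \<in> borel_measurable M" using assms by simp
  have "prob (\<Union>m\<in>J-{n}. {\<omega> \<in> space M. a < X n \<omega> \<and> b < X m \<omega>})
      \<le> (\<Sum>m\<in>J-{n}. prob {\<omega> \<in> space M. a < X n \<omega> \<and> b < X m \<omega>})"
    using assms by (intro finite_measure_subadditive_finite) (auto simp: subset_eq)
  also have "\<dots> = (\<Sum>m\<in>J-{n}. tail F a * tail F b)"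
    using assms by (intro sum.cong prob_two_gt) auto
  also have "\<dots> \<le> (\<Sum>m\<in>J. tail F a * tail F b)"
    using assms by (intro sum_mono2) (auto simp: tail_nonneg)
  also have "(\<Union>m\<in>J-{n}. {\<omega> \<in> space M. a < X n \<omega> \<and> b < X m \<omega>})
      = {\<omega> \<in> space M. a < X n \<omega> \<and> (\<exists>m\<in>J - {n}. b < X m \<omega>)}"
    by auto
  finally show ?thesis by (simp add: mult.left_commute)
qed

text \<open>A union bound over pairs combined with independence. The square is the point: where the
  one-jump bound is of the order of the rate, two jumps cost the square of the rate, which is
  negligible once the rate tends to 0.\<close>

lemma prob_ex_two_gt_le:
  assumes "finite J" "J \<subseteq> {1..}"
  shows "prob {\<omega> \<in> space M. \<exists>n\<in>J. x < X n \<omega> \<and> (\<exists>m\<in>J - {n}. x < X m \<omega>)} \<le> (real (card J) * tail F x)\<^sup>2"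
proof -
  have "prob (\<Union>n\<in>J. {\<omega> \<in> space M. x < X n \<omega> \<and> (\<exists>m\<in>J - {n}. x < X m \<omega>)})
      \<le> (\<Sum>n\<in>J. prob {\<omega> \<in> space M. x < X n \<omega> \<and> (\<exists>m\<in>J - {n}. x < X m \<omega>)})"
    using assms by (intro finite_measure_subadditive_finite)
      (auto simp: subset_eq intro!: sets.sets_Collect_conj sets.sets_Collect_finite_Ex)
  also have "\<dots> \<le> (\<Sum>n\<in>J. tail F x * (real (card J) * tail F x))"
    using assms by (intro sum_mono prob_gt_ex_other_le) auto
  also have "(\<Union>n\<in>J. {\<omega> \<in> space M. x < X n \<omega> \<and> (\<exists>m\<in>J - {n}. x < X m \<omega>)})
      = {\<omega> \<in> space M. \<exists>n\<in>J. x < X n \<omega> \<and> (\<exists>m\<in>J - {n}. x < X m \<omega>)}"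
    by auto
  finally show ?thesis
    by (simp add: power2_eq_square mult_ac)
qed

text \<open>The events are disjoint: the one for \<open>n\<close> has \<open>X n\<close> above
  \<open>a n\<close>, hence above \<open>b\<close>, while the one for any other index of
  \<open>J\<close> requires \<open>X n\<close> to be at most \<open>b\<close>. The probability of
  the union is therefore a sum, and each term loses at most the probability of a second
  exceedance.\<close>

lemma prob_single_gt_ge:
  assumes "finite K" "K \<subseteq> {1..}" "J \<subseteq> K" "\<And>n. n \<in> J \<Longrightarrow> b \<le> a n"
  shows "(\<Sum>n\<in>J. tail F (a n)) * (1 - real (card K) * tail F b)
    \<le> prob (\<Union>n\<in>J. {\<omega> \<in> space M. a n < X n \<omega> \<and> (\<forall>m\<in>K - {n}. X m \<omega> \<le> b)})"
proof -
  let ?E = "\<lambda>n. {\<omega> \<in> space M. a n < X n \<omega> \<and> (\<forall>m\<in>K - {n}. X m \<omega> \<le> b)}"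
  have E: "?E n \<in> events" if "n \<in> J" for n
    using assms that by (auto simp: subset_eq intro!: sets.sets_Collect_conj sets.sets_Collect_finite_All)
  have "(\<Sum>n\<in>J. tail F (a n)) * (1 - real (card K) * tail F b)
      = (\<Sum>n\<in>J. tail F (a n) - tail F (a n) * (real (card K) * tail F b))"
    by (simp add: sum_distrib_right right_diff_distrib sum_subtractf)
  also have "\<dots> \<le> (\<Sum>n\<in>J. prob (?E n))"
  proof (rule sum_mono)
    fix n assume n: "n \<in> J"
    let ?R = "{\<omega> \<in> space M. a n < X n \<omega> \<and> (\<exists>m\<in>K - {n}. b < X m \<omega>)}"
    have n1: "1 \<le> n" using n assms by auto
    have R: "?R \<in> events"
      using assms n1 by (auto simp: subset_eq intro!: sets.sets_Collect_conj sets.sets_Collect_finite_Ex)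
    have "tail F (a n) = prob {\<omega> \<in> space M. a n < X n \<omega>}"
      using n1 by (simp add: prob_gt)
    also have "\<dots> \<le> prob (?E n \<union> ?R)"
      using E[OF n] R by (intro finite_measure_mono) (force simp: not_less)+
    also have "\<dots> \<le> prob (?E n) + prob ?R"
      using E[OF n] R by (intro measure_Un_le) auto
    also have "prob ?R \<le> tail F (a n) * (real (card K) * tail F b)"
      using assms n1 by (intro prob_gt_ex_other_le) auto
    finally show "tail F (a n) - tail F (a n) * (real (card K) * tail F b) \<le> prob (?E n)"
      by simp
  qed
  also have "\<dots> = prob (\<Union>n\<in>J. ?E n)"
  proof (rule finite_measure_finite_Union[symmetric])
    show "disjoint_family_on ?E J"
      unfolding disjoint_family_on_def
    proof (intro ballI impI, rule ccontr)
      fix m n assume *: "m \<in> J" "n \<in> J" "m \<noteq> n" "?E m \<inter> ?E n \<noteq> {}"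
      then obtain \<omega> where "a n < X n \<omega>" "X n \<omega> \<le> b"
        using assms(3) by auto
      then show False using assms(4)[of n] * by auto
    qed
  qed (use assms E finite_subset in auto)
  finally show ?thesis .
qed

end

section \<open>Bounds for the crossing probability at a fixed level\<close>

text \<open>\<open>U\<close>, \<open>chi\<close> and the parameters stay arguments of the lemmas, so
  both bounds are inequalities at one level \<open>t\<close> and all limits are taken
  afterwards.\<close>

locale big_jump_process = iid_tail M X F for M :: "'a measure" and X F +
  fixes S :: "nat \<Rightarrow> 'a \<Rightarrow> real" and \<psi> :: "nat \<Rightarrow> nat \<Rightarrow> real \<Rightarrow> real"
    and imax :: "nat \<Rightarrow> real \<Rightarrow> nat" and t0 :: real
  assumes S_meas: "\<And>i. 1 \<le> i \<Longrightarrow> S i \<in> borel_measurable M"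
    and psi_meas: "\<And>i n. 1 \<le> i \<Longrightarrow> 1 \<le> n \<Longrightarrow> \<psi> i n \<in> borel_measurable borel"
    and imax: "\<And>n x. 1 \<le> n \<Longrightarrow> is_argmax \<psi> n x (imax n x)"
    and psi_incr: "\<And>n. 1 \<le> n \<Longrightarrow> increasing_invertible_above t0 (psi_max \<psi> n)"
begin

lemma less_psi_max_iff: "1 \<le> n \<Longrightarrow> t0 < t \<Longrightarrow> t < psi_max \<psi> n x \<longleftrightarrow> psi_inv \<psi> t0 n t < x"
  unfolding psi_inv_def by (rule increasing_invertible_above_less_iff[OF psi_incr])

lemma sets_S_gt [measurable]: "1 \<le> i \<Longrightarrow> {\<omega> \<in> space M. t < S i \<omega>} \<in> events"
  using S_meas by simp

lemma sets_ex_S_gt: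
  assumes "\<And>i. Q i \<Longrightarrow> 1 \<le> i"
  shows "{\<omega> \<in> space M. \<exists>i. Q i \<and> t < S i \<omega>} \<in> events"
proof -
  have "{\<omega> \<in> space M. \<exists>i. Q i \<and> t < S i \<omega>} = (\<Union>i\<in>Collect Q. {\<omega> \<in> space M. t < S i \<omega>})"
    by auto
  then show ?thesis
    using assms by (auto intro!: sets.countable_UN'')
qed

lemma sets_B_event: "1 \<le> n \<Longrightarrow> B_event M X chi \<theta> t n \<in> events"
  by (simp add: B_event_def)

lemma sets_C_event: "C_event M X U chi \<epsilon> \<theta> t n \<in> events"
  unfolding C_event_def B_event_def
  by (intro sets.sets_Collect_finite_All) auto

lemma sets_D_event:
  assumes "1 \<le> n"
  shows "D_event M X S \<psi> U \<epsilon> \<delta> t n \<in> events"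
proof -
  have "{\<omega> \<in> space M. \<bar>S i \<omega> - \<psi> i n (X n \<omega>)\<bar> \<le> \<delta> * t} \<in> events" if "1 \<le> i" for i
  proof -
    have [measurable]: "S i \<in> borel_measurable M" "\<psi> i n \<in> borel_measurable borel" "X n \<in> borel_measurable M"
      using S_meas psi_meas X_meas that assms by auto
    show ?thesis by measurable
  qed
  then show ?thesis
    unfolding D_event_def by (intro sets.sets_Collect_finite_All) auto
qed

text \<open>The event of \<open>S5\<close>: a crossing inside the window without a large jump up to
  that index.\<close>

abbreviation no_jump_event :: "(real \<Rightarrow> real) \<Rightarrow> (real \<Rightarrow> real) \<Rightarrow> real \<Rightarrow> real \<Rightarrow> real \<Rightarrow> 'a set" where
  "no_jump_event U chi \<epsilon> \<theta> t \<equiv> (\<Union>i\<in>I_window U \<epsilon> t.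
      {\<omega> \<in> space M. S i \<omega> > t} \<inter> (\<Inter>n\<in>{1..i}. B_event M X chi \<theta> t n))"

text \<open>The event of \<open>S6\<close>: one large jump, no other, and yet the process strays
  from its conditional mean.\<close>

abbreviation deviation_event :: "(real \<Rightarrow> real) \<Rightarrow> (real \<Rightarrow> real) \<Rightarrow> real \<Rightarrow> real \<Rightarrow> real \<Rightarrow> real \<Rightarrow> 'a set" where
  "deviation_event U chi \<epsilon> \<theta> \<delta> t \<equiv> (\<Union>n\<in>I_window U \<epsilon> t.
      (space M - B_event M X chi \<theta> t n) \<inter> C_event M X U chi \<epsilon> \<theta> t n \<inter>
      (space M - D_event M X S \<psi> U \<epsilon> \<delta> t n))"

lemma sets_no_jump_event: "no_jump_event U chi \<epsilon> \<theta> t \<in> events"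
proof (intro sets.finite_UN sets.Int finite_I_window sets.finite_INT)
  fix i assume "i \<in> I_window U \<epsilon> t"
  then show "{1..i} \<noteq> {}" "{\<omega> \<in> space M. t < S i \<omega>} \<in> events"
    by (auto simp: I_window_def)
qed (auto simp: sets_B_event)

lemma sets_deviation_event: "deviation_event U chi \<epsilon> \<theta> \<delta> t \<in> events"
  by (intro sets.finite_UN finite_I_window sets.Int sets.Diff sets.top sets_B_event sets_C_event sets_D_event)
    (auto simp: I_window_def)

text \<open>Seven events cover a crossing: it is too early, too late, or without a jump; the jump
  comes too early; there are two jumps; the process deviates; or a single jump passes the inverse at
  \<open>(1 - \<delta>) * t\<close>. The crossing index is localized by \<open>\<epsilon>\<close>,
  but the jump precedes it and may lie below \<open>\<epsilon> * U t\<close>, hence the wider window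
  for \<open>\<epsilon>'\<close>.\<close>

lemma prob_max_upper:
  assumes eps: "0 < \<epsilon>'" "\<epsilon>' \<le> \<epsilon>" and pos: "0 \<le> U t" "0 \<le> chi t"
    and th: "\<theta>' \<le> \<theta>" and t: "t0 < (1 - \<delta>) * t"
  shows "prob {\<omega> \<in> space M. \<exists>i\<ge>1. t < S i \<omega>} \<le>
      prob {\<omega> \<in> space M. \<exists>n\<ge>1. real n \<le> \<epsilon> * U t \<and> S n \<omega> > t} +
      prob {\<omega> \<in> space M. \<exists>n\<ge>1. real n \<ge> U t / \<epsilon> \<and> S n \<omega> > t} +
      prob (no_jump_event U chi \<epsilon> \<theta> t) + \<epsilon>' * (U t * tail F (\<theta> * chi t)) +
      (U t / \<epsilon>' * tail F (\<theta>' * chi t))\<^sup>2 + prob (deviation_event U chi \<epsilon>' \<theta>' \<delta> t) +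
      (\<Sum>n\<in>I_window U \<epsilon>' t. tail F (psi_inv \<psi> t0 n ((1 - \<delta>) * t)))"
    (is "prob ?E \<le> prob ?E1 + prob ?E2 + prob ?E3 + _ + _ + prob ?E6 + _")
proof -
  let ?N = "N_bound U \<epsilon>' t"
  \<comment> \<open>A jump at an index above \<open>L\<close> lies at or beyond
    \<open>\<epsilon>' * U t\<close>, so it enters the wider window.\<close>
  define L where "L = nat \<lfloor>\<epsilon>' * U t\<rfloor>"
  let ?E4 = "{\<omega> \<in> space M. \<exists>n\<in>{1..L}. \<theta> * chi t < X n \<omega>}"
  let ?E5 = "{\<omega> \<in> space M. \<exists>n\<in>{1..?N}. \<theta>' * chi t < X n \<omega> \<and> (\<exists>m\<in>{1..?N} - {n}. \<theta>' * chi t < X m \<omega>)}"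
  let ?E7 = "\<Union>n\<in>I_window U \<epsilon>' t. {\<omega> \<in> space M. psi_inv \<psi> t0 n ((1 - \<delta>) * t) < X n \<omega>}"
  have thchi: "\<theta>' * chi t \<le> \<theta> * chi t"
    using th pos by (intro mult_right_mono)
  have UU: "U t / \<epsilon> \<le> U t / \<epsilon>'"
    using eps pos by (intro divide_left_mono) auto
  have "?E \<subseteq> ?E1 \<union> ?E2 \<union> ?E3 \<union> ?E4 \<union> ?E5 \<union> ?E6 \<union> ?E7"
  proof
    fix \<omega> assume "\<omega> \<in> ?E"
    then obtain i where \<omega>: "\<omega> \<in> space M" and i: "1 \<le> i" "t < S i \<omega>" by auto
    show "\<omega> \<in> ?E1 \<union> ?E2 \<union> ?E3 \<union> ?E4 \<union> ?E5 \<union> ?E6 \<union> ?E7"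
    proof (cases "\<omega> \<in> ?E1 \<union> ?E2 \<union> ?E3 \<union> ?E4 \<union> ?E5")
      case False
      then have "\<not> real i \<le> \<epsilon> * U t" "\<not> real i \<ge> U t / \<epsilon>"
        using i \<omega> by blast+
      then have "\<epsilon> * U t < real i" "real i < U t / \<epsilon>"
        by auto
      then have iwin: "i \<in> I_window U \<epsilon> t"
        using i by (auto simp: I_window_def)
      have iN: "i \<le> ?N"
        using \<open>real i < U t / \<epsilon>\<close> UU by (auto simp: N_bound_def intro!: le_nat_floor)
      \<comment> \<open>Outside \<open>?E3\<close> a crossing at an index of the window must be
        preceded, or accompanied, by a jump.\<close>
      obtain n where n: "n \<in> {1..i}" "\<theta> * chi t < X n \<omega>"
        using False iwin i \<omega> by (auto simp: B_event_def not_le)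
      have "n \<notin> {1..L}"
        using False n \<omega> by auto
      then have "\<epsilon>' * U t \<le> real n"
        using n unfolding L_def by (auto simp: not_le) linarith
      moreover have nN: "n \<in> {1..?N}"
        using n iN by auto
      then have "real n \<le> U t / \<epsilon>'"
        using N_bound_le[of \<epsilon>' U t] eps pos by auto
      ultimately have nwin: "n \<in> I_window U \<epsilon>' t"
        using n by (auto simp: I_window_def)
      have Xn: "\<theta>' * chi t < X n \<omega>"
        using n(2) thchi by linarith
      \<comment> \<open>Outside \<open>?E5\<close> the jump at \<open>n\<close> is the only one up
        to \<open>?N\<close>, which is what \<open>C_event\<close> asks for.\<close>
      have "X m \<omega> \<le> \<theta>' * chi t" if "m \<in> {1..?N} - {n}" for m
      proof (rule ccontr)
        assume "\<not> X m \<omega> \<le> \<theta>' * chi t"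
        then have "\<exists>m\<in>{1..?N} - {n}. \<theta>' * chi t < X m \<omega>"
          using that not_le by blast
        then have "\<omega> \<in> ?E5"
          using \<omega> nN Xn by blast
        then show False
          using False by blast
      qed
      then have "\<omega> \<in> C_event M X U chi \<epsilon>' \<theta>' t n"
        using \<omega> by (simp add: C_event_def B_event_def)
      moreover have "\<omega> \<in> space M - B_event M X chi \<theta>' t n"
        using \<omega> Xn by (simp add: B_event_def)
      ultimately consider "\<omega> \<in> ?E6" | "\<omega> \<in> D_event M X S \<psi> U \<epsilon>' \<delta> t n"
        using nwin by auto
      then show ?thesis
      proof cases
        case 2
        then have "\<bar>S i \<omega> - \<psi> i n (X n \<omega>)\<bar> \<le> \<delta> * t"
          using iN i by (auto simp: D_event_def)
        \<comment> \<open>Any crossing index \<open>i\<close> serves here, since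
          \<open>psi_max\<close> dominates every \<open>\<psi> i n\<close>; the lower bound has to
          use the maximizing index.\<close>
        moreover have "\<psi> i n (X n \<omega>) \<le> psi_max \<psi> n (X n \<omega>)"
          using n i by (intro psi_le_psi_max[OF imax]) auto
        ultimately have "(1 - \<delta>) * t < psi_max \<psi> n (X n \<omega>)"
          using i by (simp add: algebra_simps)
        then have "psi_inv \<psi> t0 n ((1 - \<delta>) * t) < X n \<omega>"
          using n t by (simp add: less_psi_max_iff)
        then show ?thesis
          using nwin \<omega> by auto
      qed auto
    qed blast
  qed
  moreover have sets: "?E1 \<in> events" "?E2 \<in> events" "?E3 \<in> events" "?E4 \<in> events" "?E5 \<in> events" "?E6 \<in> events" "?E7 \<in> events"
  proof -
    show "?E1 \<in> events" "?E2 \<in> events"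
      using sets_ex_S_gt[of "\<lambda>n. 1 \<le> n \<and> real n \<le> \<epsilon> * U t" t] sets_ex_S_gt[of "\<lambda>n. 1 \<le> n \<and> real n \<ge> U t / \<epsilon>" t]
      by (simp_all add: conj_assoc)
    show "?E4 \<in> events" "?E5 \<in> events"
      by (intro sets.sets_Collect_finite_Ex sets.sets_Collect_conj; simp)+
    show "?E7 \<in> events"
      by (intro sets.finite_UN finite_I_window) (auto simp: I_window_def)
  qed (rule sets_no_jump_event sets_deviation_event)+
  ultimately have "prob ?E \<le> prob (?E1 \<union> ?E2 \<union> ?E3 \<union> ?E4 \<union> ?E5 \<union> ?E6 \<union> ?E7)"
    by (intro finite_measure_mono) auto
  also have "\<dots> \<le> prob ?E1 + prob ?E2 + prob ?E3 + prob ?E4 + prob ?E5 + prob ?E6 + prob ?E7"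
    using sets by (intro order_trans[OF measure_Un_le] add_mono order_refl sets.Un)
  also have "prob ?E4 \<le> \<epsilon>' * (U t * tail F (\<theta> * chi t))"
  proof -
    have "prob ?E4 \<le> real (card {1..L}) * tail F (\<theta> * chi t)"
      by (intro prob_ex_gt_le) auto
    also have "\<dots> \<le> \<epsilon>' * U t * tail F (\<theta> * chi t)"
      using eps pos by (intro mult_right_mono tail_nonneg) (auto simp: L_def)
    finally show ?thesis by (simp add: mult_ac)
  qed
  also have "prob ?E5 \<le> (U t / \<epsilon>' * tail F (\<theta>' * chi t))\<^sup>2"
  proof -
    have "prob ?E5 \<le> (real (card {1..?N}) * tail F (\<theta>' * chi t))\<^sup>2"
      by (intro prob_ex_two_gt_le) auto
    also have "\<dots> \<le> (U t / \<epsilon>' * tail F (\<theta>' * chi t))\<^sup>2"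
      using eps pos N_bound_le[of \<epsilon>' U t] tail_nonneg by (intro power_mono mult_right_mono) auto
    finally show ?thesis .
  qed
  also have "prob ?E7 \<le> (\<Sum>n\<in>I_window U \<epsilon>' t. tail F (psi_inv \<psi> t0 n ((1 - \<delta>) * t)))"
  proof -
    have "prob ?E7 \<le> (\<Sum>n\<in>I_window U \<epsilon>' t. prob {\<omega> \<in> space M. psi_inv \<psi> t0 n ((1 - \<delta>) * t) < X n \<omega>})"
      by (intro finite_measure_subadditive_finite finite_I_window) (auto simp: I_window_def)
    also have "\<dots> = (\<Sum>n\<in>I_window U \<epsilon>' t. tail F (psi_inv \<psi> t0 n ((1 - \<delta>) * t)))"
      by (intro sum.cong prob_gt) (auto simp: I_window_def)
    finally show ?thesis .
  qed
  finally show ?thesis by simp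
qed

text \<open>A single jump past the inverse at \<open>(1 + \<delta>) * t\<close> makes the process
  cross at the index \<open>imax\<close>, up to a deviation of \<open>\<delta> * t\<close>. The last
  term pays for jumps above \<open>chi t / \<theta>\<close>, for which \<open>range\<close> does not
  locate \<open>imax\<close>. By \<open>inv\<close> the thresholds are above
  \<open>\<theta>' * chi t\<close>, which makes the single-jump events disjoint.\<close>

lemma prob_max_lower:
  assumes eps: "0 < \<epsilon>" and pos: "0 \<le> U t" "0 \<le> chi t" and th: "\<theta>' \<le> \<theta>"
    and t: "t0 < (1 + \<delta>) * t"
    and J: "J \<subseteq> I_window U \<epsilon> t"
    and inv: "\<And>n. n \<in> J \<Longrightarrow> \<theta> * chi t \<le> psi_inv \<psi> t0 n ((1 + \<delta>) * t)"
    and range: "\<And>n x. n \<in> J \<Longrightarrow> \<theta> * chi t \<le> x \<Longrightarrow> x \<le> chi t / \<theta> \<Longrightarrow> imax n x \<in> I_window U \<epsilon> t"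
  shows "(\<Sum>n\<in>J. tail F (psi_inv \<psi> t0 n ((1 + \<delta>) * t))) * (1 - U t / \<epsilon> * tail F (\<theta>' * chi t)) \<le>
    prob {\<omega> \<in> space M. \<exists>i\<ge>1. t < S i \<omega>} + prob (deviation_event U chi \<epsilon> \<theta>' \<delta> t)
      + real (card J) * tail F (chi t / \<theta>)"
    (is "?s * _ \<le> prob ?E + prob ?D + _")
proof -
  let ?N = "N_bound U \<epsilon> t"
  let ?G = "\<Union>n\<in>J. {\<omega> \<in> space M. psi_inv \<psi> t0 n ((1 + \<delta>) * t) < X n \<omega> \<and> (\<forall>m\<in>{1..?N} - {n}. X m \<omega> \<le> \<theta>' * chi t)}"
  let ?H = "{\<omega> \<in> space M. \<exists>n\<in>J. chi t / \<theta> < X n \<omega>}"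
  have JN: "J \<subseteq> {1..?N}"
    using J I_window_subset by blast
  have finJ: "finite J"
    using J finite_subset finite_I_window by blast
  have Xmeas: "n \<in> J \<Longrightarrow> X n \<in> borel_measurable M" for n
    using JN by auto
  have thchi: "\<theta>' * chi t \<le> \<theta> * chi t"
    using th pos by (intro mult_right_mono)
  have N: "real ?N \<le> U t / \<epsilon>"
    using N_bound_le eps pos by auto
  have "?s * (1 - U t / \<epsilon> * tail F (\<theta>' * chi t)) \<le> ?s * (1 - real (card {1..?N}) * tail F (\<theta>' * chi t))"
    using N by (intro mult_left_mono sum_nonneg tail_nonneg diff_left_mono mult_right_mono) auto
  also have "\<dots> \<le> prob ?G"
    using JN inv thchi by (intro prob_single_gt_ge) (auto intro: order_trans)
  also have "?G \<subseteq> ?E \<union> ?D \<union> ?H"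
  proof
    fix \<omega> assume "\<omega> \<in> ?G"
    then obtain n where n: "n \<in> J" and \<omega>: "\<omega> \<in> space M" and Xn: "psi_inv \<psi> t0 n ((1 + \<delta>) * t) < X n \<omega>"
      and others: "\<And>m. m \<in> {1..?N} - {n} \<Longrightarrow> X m \<omega> \<le> \<theta>' * chi t" by auto
    have n1: "1 \<le> n" and nwin: "n \<in> I_window U \<epsilon> t" using n J JN by auto
    let ?i = "imax n (X n \<omega>)"
    show "\<omega> \<in> ?E \<union> ?D \<union> ?H"
    proof (cases "\<omega> \<in> ?D \<union> ?H")
      case False
      \<comment> \<open>Outside \<open>?H\<close> the jump has moderate size, so \<open>imax\<close>
        is at most \<open>?N\<close> and \<open>D_event\<close> controls the process there.\<close>
      then have "X n \<omega> \<le> chi t / \<theta>"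
        using \<omega> n JN by (auto simp: not_less)
      moreover have Xth: "\<theta> * chi t \<le> X n \<omega>"
        using Xn inv[OF n] by simp
      ultimately have "?i \<in> I_window U \<epsilon> t"
        using range[OF n] by blast
      then have i: "?i \<in> {1..?N}"
        using I_window_subset by blast
      have "\<omega> \<in> C_event M X U chi \<epsilon> \<theta>' t n"
        using others \<omega> by (auto simp: C_event_def B_event_def)
      moreover have "\<omega> \<in> space M - B_event M X chi \<theta>' t n"
        using \<omega> inv[OF n] Xn thchi by (auto simp: B_event_def)
      ultimately have "\<omega> \<in> D_event M X S \<psi> U \<epsilon> \<delta> t n"
        using nwin False \<omega> by auto
      then have "\<bar>S ?i \<omega> - \<psi> ?i n (X n \<omega>)\<bar> \<le> \<delta> * t"
        using i by (auto simp: D_event_def)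
      moreover have "\<psi> ?i n (X n \<omega>) = psi_max \<psi> n (X n \<omega>)"
        using psi_max_eq[OF imax[OF n1]] by simp
      moreover have "(1 + \<delta>) * t < psi_max \<psi> n (X n \<omega>)"
        using Xn n1 t by (simp add: less_psi_max_iff)
      ultimately have "t < S ?i \<omega>"
        by (simp add: algebra_simps)
      then show ?thesis
        using i \<omega> by auto
    qed blast
  qed
  then have "prob ?G \<le> prob (?E \<union> ?D \<union> ?H)"
    using sets_ex_S_gt[of "\<lambda>i. 1 \<le> i"] sets_deviation_event finJ Xmeas
    by (intro finite_measure_mono sets.Un sets.sets_Collect_finite_Ex) auto
  also have "\<dots> \<le> prob ?E + prob ?D + prob ?H"
    using sets_ex_S_gt[of "\<lambda>i. 1 \<le> i"] sets_deviation_event finJ Xmeas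
    by (intro order_trans[OF measure_Un_le] add_mono order_refl sets.Un sets.sets_Collect_finite_Ex) auto
  also have "prob ?H \<le> real (card J) * tail F (chi t / \<theta>)"
    using finJ JN by (intro prob_ex_gt_le) auto
  finally show ?thesis by simp
qed

end

section \<open>Iterated limits, scaling of windows and regular variation of the rate\<close>

text \<open>Working in \<open>ereal\<close> lets the supremum be infinite; a strict crossing by it
  is a crossing at some index.\<close>

lemma sup_ereal_greater_iff: "ereal t < (SUP n\<in>{1..}. ereal (f n)) \<longleftrightarrow> (\<exists>n\<ge>(1::nat). t < f n)"
  by (auto simp: less_SUP_iff)

text \<open>Turns an iterated limit into nested eventualities, so that a value of \<epsilon> can be
  fixed before \<open>t\<close> grows.\<close>

lemma eventually_less_of_Limsup_tendsto:
  fixes f :: "real \<Rightarrow> real \<Rightarrow> real"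
  assumes "((\<lambda>\<epsilon>. Limsup at_top (\<lambda>t. ereal (f \<epsilon> t))) \<longlongrightarrow> ereal l) F" "l < e"
  shows "\<forall>\<^sub>F \<epsilon> in F. \<forall>\<^sub>F t in at_top. f \<epsilon> t < e"
proof -
  have "\<forall>\<^sub>F \<epsilon> in F. Limsup at_top (\<lambda>t. ereal (f \<epsilon> t)) < ereal e"
    using assms by (intro order_tendstoD(2)[OF assms(1)]) auto
  then show ?thesis
    by eventually_elim (use Limsup_lessD in force)
qed

lemma eventually_greater_of_Liminf_tendsto:
  fixes f :: "real \<Rightarrow> real \<Rightarrow> real"
  assumes "((\<lambda>\<epsilon>. Liminf at_top (\<lambda>t. ereal (f \<epsilon> t))) \<longlongrightarrow> ereal l) F" "e < l"
  shows "\<forall>\<^sub>F \<epsilon> in F. \<forall>\<^sub>F t in at_top. e < f \<epsilon> t"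
proof -
  have "\<forall>\<^sub>F \<epsilon> in F. ereal e < Liminf at_top (\<lambda>t. ereal (f \<epsilon> t))"
    using assms by (intro order_tendstoD(1)[OF assms(1)]) auto
  then show ?thesis
    by eventually_elim (use less_LiminfD in force)
qed

lemma regularly_varyingD: "regularly_varying f \<kappa> \<Longrightarrow> 0 < c \<Longrightarrow> ((\<lambda>t. f (c * t) / f t) \<longlongrightarrow> c powr \<kappa>) at_top"
  by (simp add: regularly_varying_def)

lemma eventually_pos_at_top: "filterlim f at_top at_top \<Longrightarrow> \<forall>\<^sub>F t in at_top. 0 < (f t :: real)"
  by (simp add: filterlim_at_top_dense)

lemma eventually_scale_at_top: "\<forall>\<^sub>F t in at_top. Q t \<Longrightarrow> 0 < (c::real) \<Longrightarrow> \<forall>\<^sub>F t in at_top. Q (c * t)"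
  by (erule eventually_compose_filterlim)
    (simp add: filterlim_tendsto_pos_mult_at_top[OF tendsto_const] filterlim_ident)

lemma at_right_happens: "\<forall>\<^sub>F x in at_right (a::real). Q x \<Longrightarrow> \<exists>x. Q x"
  by (rule eventually_happens'[OF trivial_limit_at_right_real])

text \<open>The nonnegative integrand does not vanish on \<open>{1..2}\<close>, a set of positive
  measure. This makes the rate positive for large arguments.\<close>

lemma powr_integral_pos:
  fixes \<rho> :: "real \<Rightarrow> real"
  assumes cont: "continuous_on {0<..} \<rho>"
    and pos: "\<And>K. compact K \<Longrightarrow> K \<subseteq> {0<..} \<Longrightarrow> \<exists>c>0. \<forall>x\<in>K. c \<le> \<rho> x"
    and int: "set_integrable lborel {0..} (\<lambda>v. \<rho> v powr \<kappa>)"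
  shows "0 < (LINT v:{0..}|lborel. \<rho> v powr \<kappa>)"
proof -
  let ?f = "\<lambda>v. indicator {0..} v *\<^sub>R \<rho> v powr \<kappa>"
  have "0 \<le> integral\<^sup>L lborel ?f"
    by (intro integral_nonneg_AE) auto
  moreover have "integral\<^sup>L lborel ?f \<noteq> 0"
  proof
    assume "integral\<^sup>L lborel ?f = 0"
    then have "AE v in lborel. ?f v = 0"
      using int unfolding set_integrable_def by (subst (asm) integral_nonneg_eq_0_iff_AE) auto
    moreover have "?f v \<noteq> 0" if "v \<in> {1..2}" for v
      using pos[of "{1..2}"] that by fastforce
    ultimately have "AE v in lborel. v \<notin> {1..2::real}"
      by (auto elim!: eventually_mono)
    then have "emeasure lborel {1..2::real} = 0"
      by (rule AE_iff_measurable[THEN iffD1, rotated 2]) auto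
    then show False by (subst (asm) emeasure_lborel_Icc) auto
  qed
  ultimately show ?thesis
    unfolding set_lebesgue_integral_def by linarith
qed

text \<open>\<open>U (c * t)\<close> and \<open>U t\<close> are comparable, so a window at level
  \<open>c * t\<close> fits in a wider one at level \<open>t\<close>.\<close>

lemma I_window_scale:
  assumes rv: "regularly_varying U \<kappa>" and U: "filterlim U at_top at_top" and "0 < c" "0 < \<epsilon>"
  obtains \<epsilon>' where "0 < \<epsilon>'" "\<epsilon>' < 1" "\<forall>\<^sub>F t in at_top. I_window U \<epsilon> (c * t) \<subseteq> I_window U \<epsilon>' t"
proof -
  define L where "L = c powr \<kappa>"
  have L: "0 < L" using \<open>0 < c\<close> by (simp add: L_def)
  have lim: "((\<lambda>t. U (c * t) / U t) \<longlongrightarrow> L) at_top"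
    using regularly_varyingD[OF rv \<open>0 < c\<close>] by (simp add: L_def)
  \<comment> \<open>The last two bounds handle the lower and upper ends of the window; the factors
    1/2 and 2 are slack around the limit \<open>L\<close>.\<close>
  define \<epsilon>' where "\<epsilon>' = min (1/2) (min (\<epsilon> * (L / 2)) (\<epsilon> / (2 * L)))"
  have e: "0 < \<epsilon>'" "\<epsilon>' < 1" "\<epsilon>' \<le> \<epsilon> * (L / 2)" "\<epsilon>' \<le> \<epsilon> / (2 * L)"
    using L \<open>0 < \<epsilon>\<close> by (auto simp: \<epsilon>'_def)
  have "\<forall>\<^sub>F t in at_top. L / 2 < U (c * t) / U t" "\<forall>\<^sub>F t in at_top. U (c * t) / U t < 2 * L"
    using L order_tendstoD[OF lim, of "L / 2"] order_tendstoD[OF lim, of "2 * L"] by simp_all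
  then have "\<forall>\<^sub>F t in at_top. I_window U \<epsilon> (c * t) \<subseteq> I_window U \<epsilon>' t"
    using eventually_pos_at_top[OF U]
  proof eventually_elim
    case (elim t)
    then have "L / 2 * U t < U (c * t)" "U (c * t) < 2 * L * U t"
      by (simp_all add: divide_simps mult_ac)
    have "\<epsilon>' * U t \<le> \<epsilon> * (L / 2) * U t"
      using e elim by (intro mult_right_mono) auto
    also have "\<dots> \<le> \<epsilon> * U (c * t)"
      using \<open>L / 2 * U t < U (c * t)\<close> \<open>0 < \<epsilon>\<close> by (simp only: mult.assoc) (intro mult_left_mono; simp)
    finally have 1: "\<epsilon>' * U t \<le> \<epsilon> * U (c * t)" .
    have "U (c * t) / \<epsilon> \<le> 2 * L * U t / \<epsilon>"
      using \<open>U (c * t) < 2 * L * U t\<close> \<open>0 < \<epsilon>\<close> by (intro divide_right_mono) auto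
    also have "\<dots> = U t / (\<epsilon> / (2 * L))"
      using L by simp
    also have "\<dots> \<le> U t / \<epsilon>'"
      using e elim L \<open>0 < \<epsilon>\<close> by (intro divide_left_mono) auto
    finally show ?case
      using 1 by (auto simp: I_window_def)
  qed
  with e show thesis by (intro that)
qed

text \<open>An index \<open>n\<close> of the window equals \<open>x * U t\<close> exactly for
  \<open>x = n / U t\<close>, which lies in the compact interval
  \<open>{\<epsilon>..1 / \<epsilon>}\<close>. There the uniform limit and the lower bound on
  \<open>\<rho>\<close> hold together.\<close>

lemma psi_inv_window_lower:
  assumes pos: "\<And>K. compact K \<Longrightarrow> K \<subseteq> {0<..} \<Longrightarrow> \<exists>c>0. \<forall>x\<in>K. c \<le> \<rho> x"
    and unif: "\<And>K. compact K \<Longrightarrow> K \<subseteq> {0<..} \<Longrightarrow>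
      uniform_limit K (\<lambda>t x. psi_inv \<psi> t0 (nat \<lfloor>x * U t\<rfloor>) t / (chi t * \<rho> x)) (\<lambda>_. 1) at_top"
    and U: "filterlim U at_top at_top" and chi: "filterlim chi at_top at_top" and "0 < \<epsilon>"
  obtains c where "0 < c" "\<forall>\<^sub>F t in at_top. \<forall>n\<in>I_window U \<epsilon> t. c * chi t \<le> psi_inv \<psi> t0 n t"
proof -
  let ?K = "{\<epsilon>..1 / \<epsilon>}"
  have K: "compact ?K" "?K \<subseteq> {0<..}" using \<open>0 < \<epsilon>\<close> by auto
  obtain c where c: "0 < c" "\<And>x. x \<in> ?K \<Longrightarrow> c \<le> \<rho> x" using pos[OF K] by auto
  have "\<forall>\<^sub>F t in at_top. \<forall>x\<in>?K. dist (psi_inv \<psi> t0 (nat \<lfloor>x * U t\<rfloor>) t / (chi t * \<rho> x)) 1 < 1/2"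
    using uniform_limitD[OF unif[OF K], of "1/2"] by simp
  then have "\<forall>\<^sub>F t in at_top. \<forall>n\<in>I_window U \<epsilon> t. c / 2 * chi t \<le> psi_inv \<psi> t0 n t"
    using eventually_pos_at_top[OF U] eventually_pos_at_top[OF chi]
  proof eventually_elim
    case (elim t)
    show ?case
    proof
      fix n assume n: "n \<in> I_window U \<epsilon> t"
      define x where "x = real n / U t"
      have x: "x \<in> ?K" "nat \<lfloor>x * U t\<rfloor> = n"
        using n elim \<open>0 < \<epsilon>\<close> by (auto simp: I_window_def x_def field_simps)
      have "1/2 < psi_inv \<psi> t0 n t / (chi t * \<rho> x)"
        using bspec[OF elim(1) x(1)] unfolding x(2) dist_real_def by linarith
      moreover have "0 < chi t * \<rho> x"
        using c x elim by (intro mult_pos_pos) (auto intro: less_le_trans)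
      ultimately have "1/2 * (chi t * \<rho> x) < psi_inv \<psi> t0 n t"
        by (simp add: pos_less_divide_eq)
      moreover have "c / 2 * chi t \<le> 1/2 * (chi t * \<rho> x)"
        using c(2)[OF x(1)] elim by simp
      ultimately show "c / 2 * chi t \<le> psi_inv \<psi> t0 n t"
        by linarith
    qed
  qed
  with c show thesis by (intro that[of "c / 2"]) auto
qed

lemma tail_chi_pos:
  assumes "regularly_varying (tail F) \<kappa>" "filterlim chi at_top at_top"
  shows "\<forall>\<^sub>F t in at_top. 0 < tail F (chi t)"
proof -
  obtain a where "\<forall>t\<ge>a. 0 < tail F t"
    using assms(1) unfolding regularly_varying_def by blast
  then have "\<forall>\<^sub>F t in at_top. 0 < tail F t"
    unfolding eventually_at_top_linorder by blast
  then show ?thesis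
    using assms(2) by (rule eventually_compose_filterlim)
qed

lemma rate_pos:
  assumes "regularly_varying (tail F) \<kappa>" "filterlim U at_top at_top" "filterlim chi at_top at_top"
    and "0 < (LINT v:{0..}|lborel. \<rho> v powr (- \<alpha>))"
  shows "\<forall>\<^sub>F t in at_top. 0 < rate \<alpha> F U chi \<rho> t"
  using tail_chi_pos[OF assms(1,3)] eventually_pos_at_top[OF assms(2)]
  by eventually_elim (simp add: rate_def assms(4))

text \<open>The factor \<open>U t\<close> cancels. Thus a jump above a fixed multiple of
  \<open>chi t\<close> among order \<open>U t\<close> indices has probability at most of the order
  of the rate.\<close>

lemma U_tail_over_rate_tendsto:
  assumes "antimono (tail F)" "regularly_varying (tail F) (-\<alpha>)"
    and U: "filterlim U at_top at_top" and chi: "filterlim chi at_top at_top" and "0 < \<theta>"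
  shows "((\<lambda>t. U t * tail F (\<theta> * chi t) / rate \<alpha> F U chi \<rho> t) \<longlongrightarrow>
    \<theta> powr (-\<alpha>) / (LINT v:{0..}|lborel. \<rho> v powr (- \<alpha>))) at_top"
proof (rule Lim_transform_eventually)
  have "\<forall>\<^sub>F t in at_top. \<theta> = \<theta> * chi t / chi t"
    using eventually_pos_at_top[OF chi] by eventually_elim simp
  then have "((\<lambda>t. \<theta> * chi t / chi t) \<longlongrightarrow> \<theta>) at_top"
    by (rule Lim_transform_eventually[OF tendsto_const])
  from tendsto_mult_right[OF tail_ratio_tendsto[OF assms(1,2) \<open>0 < \<theta>\<close> chi this],
      of "1 / (LINT v:{0..}|lborel. \<rho> v powr (- \<alpha>))"]
  show "((\<lambda>t. tail F (\<theta> * chi t) / tail F (chi t) / (LINT v:{0..}|lborel. \<rho> v powr (- \<alpha>))) \<longlongrightarrow>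
    \<theta> powr (-\<alpha>) / (LINT v:{0..}|lborel. \<rho> v powr (- \<alpha>))) at_top"
    by simp
  show "\<forall>\<^sub>F t in at_top. tail F (\<theta> * chi t) / tail F (chi t) / (LINT v:{0..}|lborel. \<rho> v powr (- \<alpha>)) =
      U t * tail F (\<theta> * chi t) / rate \<alpha> F U chi \<rho> t"
    using eventually_pos_at_top[OF U] by eventually_elim (simp add: rate_def)
qed

text \<open>The integral cancels and the exponents add. The ratio \<open>chi (c * t) / chi t\<close>
  only converges, so the definition of regular variation of the tail must be replaced by
  \<open>tail_ratio_tendsto\<close>.\<close>

lemma rate_scale_tendsto:
  assumes "antimono (tail F)" "regularly_varying (tail F) (-\<alpha>)"
    and U: "regularly_varying U \<kappa>"
    and chi: "regularly_varying chi \<kappa>'" "filterlim chi at_top at_top"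
    and I: "0 < (LINT v:{0..}|lborel. \<rho> v powr (- \<alpha>))" and "0 < c"
  shows "((\<lambda>t. rate \<alpha> F U chi \<rho> (c * t) / rate \<alpha> F U chi \<rho> t) \<longlongrightarrow> c powr (\<kappa> - \<kappa>' * \<alpha>)) at_top"
proof -
  have "((\<lambda>t. tail F (chi (c * t)) / tail F (chi t)) \<longlongrightarrow> (c powr \<kappa>') powr (-\<alpha>)) at_top"
    using \<open>0 < c\<close> by (intro tail_ratio_tendsto[OF assms(1,2) _ chi(2)] regularly_varyingD chi) auto
  from tendsto_mult[OF regularly_varyingD[OF U \<open>0 < c\<close>] this] show ?thesis
    using I by (simp add: rate_def powr_powr flip: powr_add)
qed

text \<open>The difference of the two sides is \<open>e * e * (3 - e)\<close>.\<close>

lemma one_minus_cube_ge: "0 \<le> e \<Longrightarrow> e \<le> 1 \<Longrightarrow> 1 - 3 * e \<le> (1 - e) * (1 - e) * (1 - (e::real))"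
proof -
  assume "0 \<le> e" "e \<le> 1"
  then have "0 \<le> e * e * (3 - e)" by simp
  then show ?thesis by (simp add: algebra_simps)
qed

section \<open>Asymptotic equivalence of the crossing probability and the rate\<close>

theorem theorem3p2p1:
  fixes P :: "'a measure"
    and X S :: "nat \<Rightarrow> 'a \<Rightarrow> real"
    and s :: "nat \<Rightarrow> (nat \<Rightarrow> real) \<Rightarrow> real"
    and F U chi \<rho> :: "real \<Rightarrow> real"
    and \<alpha> t0 :: real
    and \<psi> :: "nat \<Rightarrow> nat \<Rightarrow> real \<Rightarrow> real"
    and imax :: "nat \<Rightarrow> real \<Rightarrow> nat"
  assumes prob: "prob_space P"
    and alpha: "0 < \<alpha>"
    and indep: "prob_space.indep_vars P (\<lambda>_. borel) X {1..}"
    and ident: "\<And>n. 1 \<le> n \<Longrightarrow> cdf (distr P borel (X n)) = F"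
    and tail_rv: "regularly_varying (tail F) (- \<alpha>)"
    and s_meas: "\<And>n. 1 \<le> n \<Longrightarrow> s n \<in> borel_measurable (Pi\<^sub>M {1..} (\<lambda>_. borel))"
    and S_fun: "\<And>n \<omega>. 1 \<le> n \<Longrightarrow> \<omega> \<in> space P \<Longrightarrow> S n \<omega> = s n (\<lambda>k\<in>{1..}. X k \<omega>)"
    and psi_cond: "\<And>i n. 1 \<le> i \<Longrightarrow> 1 \<le> n \<Longrightarrow> cond_exp_version P (S i) (X n) (\<psi> i n)"
    and imax: "\<And>n x. 1 \<le> n \<Longrightarrow> is_argmax \<psi> n x (imax n x)"
    and psi_incr: "\<And>n. 1 \<le> n \<Longrightarrow> increasing_invertible_above t0 (psi_max \<psi> n)"
    and S1_U: "\<exists>\<kappa>. regularly_varying U \<kappa>" "filterlim U at_top at_top"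
    and S1_chi: "\<exists>\<kappa>. regularly_varying chi \<kappa>" "filterlim chi at_top at_top"
    and S1_rho: "continuous_on {0<..} \<rho>"
      "\<And>K. compact K \<Longrightarrow> K \<subseteq> {0<..} \<Longrightarrow> \<exists>c>0. \<forall>x\<in>K. c \<le> \<rho> x"
      "set_integrable lborel {0..} (\<lambda>v. \<rho> v powr (- \<alpha>))"
    and S1_unif: "\<And>K. compact K \<Longrightarrow> K \<subseteq> {0<..} \<Longrightarrow>
      uniform_limit K (\<lambda>t x. psi_inv \<psi> t0 (nat \<lfloor>x * U t\<rfloor>) t / (chi t * \<rho> x)) (\<lambda>_. 1) at_top"
    and S2_zero: "(rate \<alpha> F U chi \<rho> \<longlongrightarrow> 0) at_top"
    and S2_summable: "\<forall>\<^sub>F t in at_top. (\<lambda>n. tail F (psi_inv \<psi> t0 n t)) summable_on {1..}"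
    and S2_sum: "rate \<alpha> F U chi \<rho> \<sim>[at_top] (\<lambda>t. \<Sum>\<^sub>\<infinity>n\<in>{1..}. tail F (psi_inv \<psi> t0 n t))"
    and S2_liminf: "((\<lambda>\<epsilon>. Liminf at_top (\<lambda>t. ereal (1 / rate \<alpha> F U chi \<rho> t *
        (\<Sum>n\<in>I_window U \<epsilon> t. tail F (psi_inv \<psi> t0 n t))))) \<longlongrightarrow> 1) (at_right 0)"
    and S2_limsup: "((\<lambda>\<epsilon>. Limsup at_top (\<lambda>t. ereal (1 / rate \<alpha> F U chi \<rho> t *
        (\<Sum>n\<in>I_window U \<epsilon> t. tail F (psi_inv \<psi> t0 n t))))) \<longlongrightarrow> 1) (at_right 0)"
    and S3: "((\<lambda>\<epsilon>. Limsup at_top (\<lambda>t. ereal (1 / rate \<alpha> F U chi \<rho> t *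
        \<P>(\<omega> in P. \<exists>n\<ge>1. real n \<le> \<epsilon> * U t \<and> S n \<omega> > t)))) \<longlongrightarrow> 0) (at_right 0)"
    and S4: "((\<lambda>\<epsilon>. Limsup at_top (\<lambda>t. ereal (1 / rate \<alpha> F U chi \<rho> t *
        \<P>(\<omega> in P. \<exists>n\<ge>1. real n \<ge> U t / \<epsilon> \<and> S n \<omega> > t)))) \<longlongrightarrow> 0) (at_right 0)"
    and S5: "\<And>\<epsilon>. 0 < \<epsilon> \<Longrightarrow> \<epsilon> < 1 \<Longrightarrow> \<exists>\<theta>>0.
        (\<lambda>t. measure P (\<Union>i\<in>I_window U \<epsilon> t.
            {\<omega> \<in> space P. S i \<omega> > t} \<inter> (\<Inter>n\<in>{1..i}. B_event P X chi \<theta> t n)))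
          \<in> o[at_top](rate \<alpha> F U chi \<rho>)"
    and S6: "\<And>\<epsilon> \<delta>. 0 < \<epsilon> \<Longrightarrow> \<epsilon> < 1 \<Longrightarrow> 0 < \<delta> \<Longrightarrow> \<forall>\<^sub>F \<theta> in at_right 0.
        (\<lambda>t. measure P (\<Union>n\<in>I_window U \<epsilon> t.
            (space P - B_event P X chi \<theta> t n) \<inter> C_event P X U chi \<epsilon> \<theta> t n \<inter>
            (space P - D_event P X S \<psi> U \<epsilon> \<delta> t n)))
          \<in> o[at_top](rate \<alpha> F U chi \<rho>)"
    and S7: "\<And>\<delta> \<theta>. 0 < \<delta> \<Longrightarrow> \<delta> < 1 \<Longrightarrow> 0 < \<theta> \<Longrightarrow> \<theta> < 1 \<Longrightarrow> \<exists>\<eta>>0. \<forall>\<^sub>F t in at_top.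
        {imax n x | n x. \<theta> * chi t \<le> x \<and> x \<le> chi t / \<theta> \<and> n \<in> I_window U \<delta> t} \<subseteq> I_window U \<eta> t"
  shows "(\<lambda>t. \<P>(\<omega> in P. (SUP n\<in>{1..}. ereal (S n \<omega>)) > ereal t)) \<sim>[at_top] rate \<alpha> F U chi \<rho>"
proof -
  interpret prob_space P by (rule prob)
  have X_meas: "X n \<in> borel_measurable P" if "1 \<le> n" for n
    using indep that by (auto simp: indep_vars_def)
  have S_meas: "S n \<in> borel_measurable P" if "1 \<le> n" for n
  proof -
    have "(\<lambda>\<omega>. \<lambda>k\<in>{1..}. X k \<omega>) \<in> measurable P (Pi\<^sub>M {1..} (\<lambda>_. borel))"
      by (intro measurable_restrict) (simp add: X_meas)
    from measurable_compose[OF this s_meas[OF that]] show ?thesis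
      by (rule measurable_cong[THEN iffD1, rotated]) (simp add: S_fun[OF that])
  qed
  interpret big_jump_process P X F S \<psi> imax t0
    using indep ident S_meas psi_cond imax psi_incr
    by unfold_locales (auto simp: cond_exp_version_def)
  define R where "R = rate \<alpha> F U chi \<rho>"
  define I where "I = (LINT v:{0..}|lborel. \<rho> v powr (- \<alpha>))"
  define p where "p = (\<lambda>t. prob {\<omega> \<in> space P. \<exists>i\<ge>1. t < S i \<omega>})"
  note S2_sum = S2_sum[folded R_def] and S2_liminf = S2_liminf[folded R_def]
    and S3 = S3[folded R_def] and S4 = S4[folded R_def] and S5 = S5[folded R_def] and S6 = S6[folded R_def]
  have R0: "(R \<longlongrightarrow> 0) at_top" using S2_zero by (simp add: R_def)
  obtain \<kappa>U \<kappa>c where rv: "regularly_varying U \<kappa>U" "regularly_varying chi \<kappa>c"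
    using S1_U S1_chi by blast
  have Ipos: "0 < I"
    unfolding I_def by (rule powr_integral_pos[OF S1_rho])
  define \<kappa> where "\<kappa> = \<kappa>U - \<kappa>c * \<alpha>"
  have Rpos: "\<forall>\<^sub>F t in at_top. 0 < R t"
    unfolding R_def using Ipos by (intro rate_pos[OF tail_rv S1_U(2) S1_chi(2)]) (simp add: I_def)
  have Rscale: "((\<lambda>t. R (c * t) / R t) \<longlongrightarrow> c powr \<kappa>) at_top" if "0 < c" for c
    unfolding R_def \<kappa>_def using Ipos that
    by (intro rate_scale_tendsto[OF antimono_tail tail_rv rv S1_chi(2)]) (auto simp: I_def)
  have UT: "((\<lambda>t. U t * tail F (\<theta> * chi t) / R t) \<longlongrightarrow> \<theta> powr (-\<alpha>) / I) at_top" if "0 < \<theta>" for \<theta>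
    unfolding R_def I_def by (rule U_tail_over_rate_tendsto[OF antimono_tail tail_rv S1_U(2) S1_chi(2) that])
  \<comment> \<open>Being of the order of \<open>R\<close>, this quantity vanishes with
    \<open>R\<close>; as the second factor of a square it makes the two-jump term
    \<open>o(R)\<close>.\<close>
  have UT0: "((\<lambda>t. U t * tail F (\<theta> * chi t)) \<longlongrightarrow> 0) at_top" if "0 < \<theta>" for \<theta>
  proof (rule Lim_transform_eventually)
    show "((\<lambda>t. U t * tail F (\<theta> * chi t) / R t * R t) \<longlongrightarrow> 0) at_top"
      using tendsto_mult[OF UT[OF that] R0] by simp
    show "\<forall>\<^sub>F t in at_top. U t * tail F (\<theta> * chi t) / R t * R t = U t * tail F (\<theta> * chi t)"
      using Rpos by eventually_elim simp
  qed
  have small: "\<forall>\<^sub>F t in at_top. f t / R t < e" if "f \<in> o[at_top](R)" "0 < e" for f e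
    using smalloD_tendsto[OF that(1)] that(2) by (rule order_tendstoD(2))
  have upos: "\<forall>\<^sub>F t in at_top. 0 < U t" "\<forall>\<^sub>F t in at_top. 0 < chi t"
    by (rule eventually_pos_at_top, fact)+
  have "((\<lambda>t. p t / R t) \<longlongrightarrow> 1) at_top"
  proof (rule order_tendstoI)

    \<comment> \<open>Upper bound for the ratio\<close>
    fix b :: real assume "1 < b"
    \<comment> \<open>Six error terms below \<open>e\<close> and a main term below
      \<open>1 + e\<close> add up to \<open>b\<close>.\<close>
    define e where "e = (b - 1) / 7"
    have e: "0 < e" "b = 1 + 7 * e" using \<open>1 < b\<close> by (auto simp: e_def field_simps)
    have "\<forall>\<^sub>F \<delta> in at_right 0. (1 - \<delta>) powr \<kappa> < 1 + e"
      using e by (intro order_tendstoD(2)[of _ 1]) (auto intro!: tendsto_eq_intros)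
    then have "\<forall>\<^sub>F \<delta> in at_right 0. (1 - \<delta>) powr \<kappa> < 1 + e \<and> \<delta> \<in> {0<..<1}"
      by (intro eventually_conj eventually_at_right_real) auto
    from at_right_happens[OF this] obtain \<delta> where \<delta>: "(1 - \<delta>) powr \<kappa> < 1 + e" "0 < \<delta>" "\<delta> < 1"
      by auto
    define c where "c = 1 - \<delta>"
    have c: "0 < c" "c powr \<kappa> < 1 + e" using \<delta> by (auto simp: c_def)
    have "\<forall>\<^sub>F \<epsilon> in at_right 0. (\<forall>\<^sub>F t in at_top. 1 / R t * prob {\<omega> \<in> space P. \<exists>n\<ge>1. real n \<le> \<epsilon> * U t \<and> S n \<omega> > t} < e)
        \<and> (\<forall>\<^sub>F t in at_top. 1 / R t * prob {\<omega> \<in> space P. \<exists>n\<ge>1. real n \<ge> U t / \<epsilon> \<and> S n \<omega> > t} < e) \<and> \<epsilon> \<in> {0<..<1}"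
      using S3 S4 e unfolding zero_ereal_def
      by (intro eventually_conj eventually_at_right_real eventually_less_of_Limsup_tendsto) auto
    from at_right_happens[OF this] obtain \<epsilon> where \<epsilon>: "0 < \<epsilon>" "\<epsilon> < 1"
      and ev1: "\<forall>\<^sub>F t in at_top. 1 / R t * prob {\<omega> \<in> space P. \<exists>n\<ge>1. real n \<le> \<epsilon> * U t \<and> S n \<omega> > t} < e"
      and ev2: "\<forall>\<^sub>F t in at_top. 1 / R t * prob {\<omega> \<in> space P. \<exists>n\<ge>1. real n \<ge> U t / \<epsilon> \<and> S n \<omega> > t} < e"
      by auto
    obtain \<theta> where \<theta>: "0 < \<theta>" and o5: "(\<lambda>t. prob (no_jump_event U chi \<epsilon> \<theta> t)) \<in> o[at_top](R)"
      using S5[OF \<epsilon>] by blast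
    \<comment> \<open>This is the limit, relative to \<open>R\<close>, of the bound for an early
      jump above \<open>\<theta> * chi t\<close>; with \<open>\<theta>\<close> already fixed it can
      still be made small.\<close>
    have "((\<lambda>\<epsilon>'. \<epsilon>' * (\<theta> powr (-\<alpha>) / I)) \<longlongrightarrow> 0) (at_right 0)"
      using Ipos by (auto intro!: tendsto_eq_intros)
    then have "\<forall>\<^sub>F \<epsilon>' in at_right 0. \<epsilon>' * (\<theta> powr (-\<alpha>) / I) < e \<and> \<epsilon>' \<in> {0<..<\<epsilon>}"
      using e \<epsilon> by (intro eventually_conj eventually_at_right_real order_tendstoD(2)) auto
    from at_right_happens[OF this] obtain \<epsilon>' where \<epsilon>': "0 < \<epsilon>'" "\<epsilon>' < \<epsilon>" "\<epsilon>' * (\<theta> powr (-\<alpha>) / I) < e"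
      by auto
    have "\<forall>\<^sub>F \<theta>' in at_right 0. (\<lambda>t. prob (deviation_event U chi \<epsilon>' \<theta>' \<delta> t)) \<in> o[at_top](R) \<and> \<theta>' \<in> {0<..<\<theta>}"
      using \<epsilon> \<epsilon>' \<theta> \<delta> by (intro eventually_conj eventually_at_right_real S6) auto
    from at_right_happens[OF this] obtain \<theta>' where \<theta>': "0 < \<theta>'" "\<theta>' < \<theta>"
      and o6: "(\<lambda>t. prob (deviation_event U chi \<epsilon>' \<theta>' \<delta> t)) \<in> o[at_top](R)"
      by auto
    have ev4: "\<forall>\<^sub>F t in at_top. \<epsilon>' * (U t * tail F (\<theta> * chi t) / R t) < e"
      using tendsto_mult_left[OF UT[OF \<theta>]] \<epsilon>'(3) by (rule order_tendstoD(2))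
    \<comment> \<open>The two-jump term divided by \<open>R t\<close>, written as a convergent
      factor times one tending to 0.\<close>
    have "((\<lambda>t. (U t * tail F (\<theta>' * chi t) / R t) * (U t * tail F (\<theta>' * chi t)) / \<epsilon>'\<^sup>2) \<longlongrightarrow> 0) at_top"
      using tendsto_divide[OF tendsto_mult[OF UT UT0] tendsto_const[of "\<epsilon>'\<^sup>2"]] \<theta>' \<epsilon>' by force
    then have ev5: "\<forall>\<^sub>F t in at_top. (U t * tail F (\<theta>' * chi t) / R t) * (U t * tail F (\<theta>' * chi t)) / \<epsilon>'\<^sup>2 < e"
      using e by (intro order_tendstoD(2)) auto
    let ?T = "\<lambda>t. \<Sum>\<^sub>\<infinity>n\<in>{1..}. tail F (psi_inv \<psi> t0 n t)"
    \<comment> \<open>The definition of \<open>asymp_equiv\<close> assigns 1 to 0/0; positivity of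
      \<open>R\<close> excludes that case.\<close>
    have "((\<lambda>t. ?T t / R t) \<longlongrightarrow> 1) at_top"
      using asymp_equiv_symI[OF S2_sum] Rpos unfolding asymp_equiv_def
      by (rule Lim_transform_eventually[OF _ eventually_mono]) auto
    then have "((\<lambda>t. ?T (c * t) / R (c * t)) \<longlongrightarrow> 1) at_top"
      by (rule filterlim_compose)
        (simp add: filterlim_tendsto_pos_mult_at_top[OF tendsto_const] filterlim_ident c)
    from tendsto_mult[OF this Rscale[OF c(1)]]
    have ev7: "\<forall>\<^sub>F t in at_top. ?T (c * t) / R (c * t) * (R (c * t) / R t) < 1 + e"
      using c by (intro order_tendstoD(2)) auto
    have ct: "\<forall>\<^sub>F t in at_top. t0 < c * t"
      using c by (intro eventually_scale_at_top eventually_gt_at_top)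
    show "\<forall>\<^sub>F t in at_top. p t / R t < b"
      using ev1 ev2 small[OF o5 \<open>0 < e\<close>] ev4 ev5 small[OF o6 \<open>0 < e\<close>] ev7 Rpos
        eventually_scale_at_top[OF Rpos c(1)] ct upos eventually_scale_at_top[OF S2_summable c(1)]
    proof eventually_elim
      case (elim t)
      let ?s = "\<Sum>n\<in>I_window U \<epsilon>' t. tail F (psi_inv \<psi> t0 n (c * t))"
      \<comment> \<open>The window belongs to \<open>t\<close> but the thresholds to
        \<open>c * t\<close>. Passing to the full series avoids comparing windows; summability
        matters because \<open>infsum\<close> is 0 by default.\<close>
      have "?s \<le> ?T (c * t)"
        using elim(13) by (intro finite_sum_le_infsum finite_I_window) (auto simp: I_window_def tail_nonneg)
      then have "?s / R t \<le> ?T (c * t) / R t"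
        using elim by (intro divide_right_mono) auto
      also have "\<dots> < 1 + e"
        using elim by simp
      finally have s: "?s / R t < 1 + e" .
      have "p t \<le> prob {\<omega> \<in> space P. \<exists>n\<ge>1. real n \<le> \<epsilon> * U t \<and> S n \<omega> > t} +
          prob {\<omega> \<in> space P. \<exists>n\<ge>1. real n \<ge> U t / \<epsilon> \<and> S n \<omega> > t} +
          prob (no_jump_event U chi \<epsilon> \<theta> t) + \<epsilon>' * (U t * tail F (\<theta> * chi t)) +
          (U t / \<epsilon>' * tail F (\<theta>' * chi t))\<^sup>2 + prob (deviation_event U chi \<epsilon>' \<theta>' \<delta> t) + ?s"
        unfolding p_def c_def using elim \<epsilon>' \<theta>' by (intro prob_max_upper) (auto simp: c_def)
      then have "p t / R t \<le> \<dots> / R t"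
        using elim by (intro divide_right_mono) auto
      also have "\<dots> < e + e + e + e + e + e + (1 + e)"
        unfolding add_divide_distrib using elim s
        by (intro add_strict_mono) (auto simp: power2_eq_square mult_ac)
      finally show ?case using e by simp
    qed
  next

    \<comment> \<open>Lower bound for the ratio\<close>
    fix b :: real assume "b < 1"
    \<comment> \<open>Three factors above \<open>1 - e\<close> and two errors below \<open>e\<close>
      give \<open>1 - 5 * e\<close>; the cap 1/2 keeps the factors positive.\<close>
    define e where "e = min ((1 - b) / 5) (1 / 2)"
    have e: "0 < e" "e < 1" "b \<le> 1 - 5 * e" using \<open>b < 1\<close> by (auto simp: e_def min_def field_simps)
    have "\<forall>\<^sub>F \<delta> in at_right 0. 1 - e < (1 + \<delta>) powr \<kappa>"
      using e by (intro order_tendstoD(1)[of _ 1]) (auto intro!: tendsto_eq_intros)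
    then have "\<forall>\<^sub>F \<delta> in at_right 0. 1 - e < (1 + \<delta>) powr \<kappa> \<and> \<delta> \<in> {0<..<1}"
      by (intro eventually_conj eventually_at_right_real) auto
    from at_right_happens[OF this] obtain \<delta> where \<delta>: "1 - e < (1 + \<delta>) powr \<kappa>" "0 < \<delta>" "\<delta> < 1"
      by auto
    define c where "c = 1 + \<delta>"
    have c: "0 < c" "1 - e < c powr \<kappa>" using \<delta> by (auto simp: c_def)
    have "\<forall>\<^sub>F \<epsilon> in at_right 0. (\<forall>\<^sub>F t in at_top. 1 - e < 1 / R t * (\<Sum>n\<in>I_window U \<epsilon> t. tail F (psi_inv \<psi> t0 n t)))
        \<and> \<epsilon> \<in> {0<..<1}"
      using S2_liminf e unfolding one_ereal_def
      by (intro eventually_conj eventually_at_right_real eventually_greater_of_Liminf_tendsto) auto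
    from at_right_happens[OF this] obtain \<epsilon> where \<epsilon>: "0 < \<epsilon>" "\<epsilon> < 1"
      and ev1: "\<forall>\<^sub>F t in at_top. 1 - e < 1 / R t * (\<Sum>n\<in>I_window U \<epsilon> t. tail F (psi_inv \<psi> t0 n t))"
      by auto
    obtain \<epsilon>2 where \<epsilon>2: "0 < \<epsilon>2" "\<epsilon>2 < 1" and win2: "\<forall>\<^sub>F t in at_top. I_window U \<epsilon> (c * t) \<subseteq> I_window U \<epsilon>2 t"
      using I_window_scale[OF rv(1) S1_U(2) c(1) \<epsilon>(1)] .
    obtain d where d: "0 < d" "\<forall>\<^sub>F t in at_top. \<forall>n\<in>I_window U \<epsilon> t. d * chi t \<le> psi_inv \<psi> t0 n t"
      using psi_inv_window_lower[OF S1_rho(2) S1_unif S1_U(2) S1_chi(2) \<epsilon>(1)] by blast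
    \<comment> \<open>The inverse at \<open>c * t\<close> is at least
      \<open>d * chi (c * t)\<close>, and half the limiting ratio bounds \<open>chi (c * t)\<close>
      below by a multiple of \<open>chi t\<close>. Hence \<open>\<theta> < d'\<close> gives the
      hypothesis \<open>inv\<close> of \<open>prob_max_lower\<close>.\<close>
    define d' where "d' = d * (c powr \<kappa>c / 2)"
    have d': "0 < d'" using c d by (simp add: d'_def)
    have evchi: "\<forall>\<^sub>F t in at_top. c powr \<kappa>c / 2 < chi (c * t) / chi t"
      using c by (intro order_tendstoD(1)[OF regularly_varyingD[OF rv(2) c(1)]]) auto
    \<comment> \<open>Relative to \<open>R\<close>, jumps above \<open>chi t / \<theta>\<close>
      contribute at most this in the limit. It vanishes with \<open>\<theta>\<close> as
      \<open>\<alpha>\<close> is positive; \<open>inverse \<theta>\<close> is the multiple of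
      \<open>chi t\<close> fed to \<open>UT\<close>.\<close>
    have "((\<lambda>\<theta>. inverse \<theta> powr (- \<alpha>) / I / \<epsilon>2) \<longlongrightarrow> 0 / I / \<epsilon>2) (at_right 0)"
      using alpha Ipos \<epsilon>2
      by (intro tendsto_divide tendsto_const tendsto_neg_powr[OF _ filterlim_inverse_at_top_right]) auto
    then have "\<forall>\<^sub>F \<theta> in at_right 0. inverse \<theta> powr (- \<alpha>) / I / \<epsilon>2 < e \<and> \<theta> \<in> {0<..<min d' 1}"
      using e d' by (intro eventually_conj eventually_at_right_real order_tendstoD(2)) auto
    from at_right_happens[OF this] obtain \<theta> where \<theta>: "0 < \<theta>" "\<theta> < 1" "\<theta> < d'" "inverse \<theta> powr (- \<alpha>) / I / \<epsilon>2 < e"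
      by auto
    obtain \<eta> where \<eta>: "0 < \<eta>" and range: "\<forall>\<^sub>F t in at_top.
        {imax n x | n x. \<theta> * chi t \<le> x \<and> x \<le> chi t / \<theta> \<and> n \<in> I_window U \<epsilon>2 t} \<subseteq> I_window U \<eta> t"
      using S7[OF \<epsilon>2 \<theta>(1,2)] by blast
    \<comment> \<open>One window has to contain both the jump indices, by
      \<open>\<epsilon>2\<close>, and the maximizing indices, by \<open>\<eta>\<close>.\<close>
    define \<epsilon>3 where "\<epsilon>3 = min \<epsilon>2 \<eta>"
    have \<epsilon>3: "0 < \<epsilon>3" "\<epsilon>3 < 1" "\<epsilon>3 \<le> \<epsilon>2" "\<epsilon>3 \<le> \<eta>" using \<epsilon>2 \<eta> by (auto simp: \<epsilon>3_def)
    have "\<forall>\<^sub>F \<theta>' in at_right 0. (\<lambda>t. prob (deviation_event U chi \<epsilon>3 \<theta>' \<delta> t)) \<in> o[at_top](R) \<and> \<theta>' \<in> {0<..<\<theta>}"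
      using \<epsilon>3 \<theta> \<delta> by (intro eventually_conj eventually_at_right_real S6) auto
    from at_right_happens[OF this] obtain \<theta>' where \<theta>': "0 < \<theta>'" "\<theta>' < \<theta>"
      and o6: "(\<lambda>t. prob (deviation_event U chi \<epsilon>3 \<theta>' \<delta> t)) \<in> o[at_top](R)"
      by auto
    have ev2: "\<forall>\<^sub>F t in at_top. U t * tail F (inverse \<theta> * chi t) / R t / \<epsilon>2 < e"
      using tendsto_divide[OF UT tendsto_const[of \<epsilon>2]] \<theta> \<epsilon>2 by (intro order_tendstoD(2)) auto
    have "((\<lambda>t. 1 - U t * tail F (\<theta>' * chi t) / \<epsilon>3) \<longlongrightarrow> 1 - 0 / \<epsilon>3) at_top"
      using \<epsilon>3 \<theta>' by (intro tendsto_intros UT0) auto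
    then have ev3: "\<forall>\<^sub>F t in at_top. 1 - e < 1 - U t * tail F (\<theta>' * chi t) / \<epsilon>3"
      using e by (intro order_tendstoD(1)) auto
    have ev4: "\<forall>\<^sub>F t in at_top. 1 - e < R (c * t) / R t"
      using Rscale[OF c(1)] c(2) by (rule order_tendstoD(1))
    have ct: "\<forall>\<^sub>F t in at_top. t0 < c * t"
      using c by (intro eventually_scale_at_top eventually_gt_at_top)
    show "\<forall>\<^sub>F t in at_top. b < p t / R t"
      using eventually_scale_at_top[OF ev1 c(1)] win2 eventually_scale_at_top[OF d(2) c(1)] evchi range
        small[OF o6 \<open>0 < e\<close>] ev2 ev3 ev4 Rpos eventually_scale_at_top[OF Rpos c(1)] ct upos
    proof eventually_elim
      case (elim t)
      define J where "J = I_window U \<epsilon> (c * t)"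
      let ?s = "\<Sum>n\<in>J. tail F (psi_inv \<psi> t0 n (c * t))"
      have U: "0 \<le> U t" and chi: "0 \<le> chi t" using elim by auto
      have J2: "J \<subseteq> I_window U \<epsilon>2 t" using elim by (simp add: J_def)
      have "c powr \<kappa>c / 2 * chi t \<le> chi (c * t)"
        using elim by (simp add: divide_simps mult_ac split: if_splits)
      then have "d * (c powr \<kappa>c / 2 * chi t) \<le> d * chi (c * t)"
        using d by (intro mult_left_mono) auto
      moreover have "\<theta> * chi t \<le> d' * chi t"
        using \<theta> chi by (intro mult_right_mono) auto
      ultimately have dth: "\<theta> * chi t \<le> d * chi (c * t)"
        by (simp add: d'_def mult_ac)
      have lower: "?s * (1 - U t / \<epsilon>3 * tail F (\<theta>' * chi t)) \<le>
          p t + prob (deviation_event U chi \<epsilon>3 \<theta>' \<delta> t) + real (card J) * tail F (chi t / \<theta>)"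
        unfolding p_def c_def
      proof (intro prob_max_lower)
        show "J \<subseteq> I_window U \<epsilon>3 t"
          using J2 I_window_antimono[of \<epsilon>3 \<epsilon>2] \<epsilon>3 U by blast
        show "\<theta> * chi t \<le> psi_inv \<psi> t0 n ((1 + \<delta>) * t)" if "n \<in> J" for n
          using elim(3) dth that unfolding J_def c_def by fastforce
        show "imax n x \<in> I_window U \<epsilon>3 t" if "n \<in> J" "\<theta> * chi t \<le> x" "x \<le> chi t / \<theta>" for n x
        proof -
          have "imax n x \<in> I_window U \<eta> t"
            using elim(5) that J2 by blast
          then show ?thesis
            using I_window_antimono[of \<epsilon>3 \<eta>] \<epsilon>3 U by blast
        qed
      qed (use \<epsilon>3 \<theta>' U chi elim in \<open>auto simp: c_def\<close>)
      have "card J \<le> card {1..N_bound U \<epsilon>2 t}"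
        using J2 I_window_subset by (intro card_mono) blast+
      then have "real (card J) \<le> U t / \<epsilon>2"
        using N_bound_le[of \<epsilon>2 U t] \<epsilon>2 U by simp
      then have "real (card J) * tail F (chi t / \<theta>) / R t \<le> U t / \<epsilon>2 * tail F (chi t / \<theta>) / R t"
        using elim by (intro divide_right_mono mult_right_mono tail_nonneg) auto
      also have "\<dots> < e"
        using elim by (simp add: field_simps)
      finally have card: "real (card J) * tail F (chi t / \<theta>) / R t < e" .
      have "1 - 3 * e \<le> (1 - e) * (1 - e) * (1 - e)"
        using e by (intro one_minus_cube_ge) auto
      \<comment> \<open>The factors are the window sum relative to the rate at \<open>c * t\<close>,
        the change of the rate from \<open>t\<close> to \<open>c * t\<close>, and the loss from
        requiring no second jump.\<close>
      also have "\<dots> \<le> (?s / R (c * t)) * (R (c * t) / R t) * (1 - U t * tail F (\<theta>' * chi t) / \<epsilon>3)"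
        using elim e by (intro mult_mono mult_nonneg_nonneg divide_nonneg_nonneg sum_nonneg tail_nonneg) (auto simp: J_def)
      also have "\<dots> = ?s * (1 - U t / \<epsilon>3 * tail F (\<theta>' * chi t)) / R t"
        using elim by simp
      also have "\<dots> \<le> (p t + prob (deviation_event U chi \<epsilon>3 \<theta>' \<delta> t) + real (card J) * tail F (chi t / \<theta>)) / R t"
        using lower elim by (intro divide_right_mono) auto
      also have "\<dots> < p t / R t + e + e"
        unfolding add_divide_distrib using elim(6) card by linarith
      finally show ?case using e by simp
    qed
  qed
  then show ?thesis
    unfolding sup_ereal_greater_iff p_def R_def by (rule asymp_equivI')
qed

end
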